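(* Let $r\ge 1$ be an integer and let $\mathbf z=(z_1,\ldots,z_r)\in\mathbb C^r$ with $|z_i|\le 1$ for all $1\le i\le r$. Let $U_r(\mathbf z)\subseteq\mathbb C^r$ be the open set defined in the context. Then for every $(s_1,\ldots,s_r)\in U_r(\mathbf z)$ the multiple Dirichlet series $$\sum_{n_1>\cdots>n_r>0}\frac{z_1^{n_1}\cdots z_r^{n_r}}{n_1^{s_1}\cdots n_r^{s_r}}$$ converges, in the sense that the limit $$\lim_{N\to\infty}\ \sum_{N>n_1>\cdots>n_r>0}\frac{z_1^{n_1}\cdots z_r^{n_r}}{n_1^{s_1}\cdots n_r^{s_r}}$$ exists. Moreover, the sum of this series defines a holomorphic function of $(s_1,\ldots,s_r)$ on $U_r(\mathbf z)$.
   Context: The indices $n_1,\ldots,n_r$ run over positive integers. For $\mathbf z=(z_1,\ldots,z_r)$ with $|z_i|\le1$, write $z_{[1,i]}:=z_1\cdots z_i$. Let $q(\mathbf z)$ be the smallest integer $q$ with $1\le q\le r$ such that $z_{[1,q]}\ne 1$; if no such integer exists, set $q(\mathbf z)=r+1$. Define $$U_r(\mathbf z):=\{(s_1,\ldots,s_r)\in\mathbb C^r:\ \Re(s_1+\cdots+s_i)>i \text{ if } 1\le i<q(\mathbf z),\ \text{ and }\ \Re(s_1+\cdots+s_i)>i-1 \text{ if } q(\mathbf z)\le i\le r\}.$$ *)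

theory Defs
  imports "HOL-Analysis.Analysis"
begin

text \<open>
  The space of \<open>r\<close>-tuples of complex numbers is \<open>complex ^ 'r\<close>, where the index type \<open>'r\<close> is an
  arbitrary finite linear order with \<open>r = CARD('r) \<ge> 1\<close> elements. The order is what gives meaning
  to ``the first \<open>k\<close> indices''; \<open>pos\<close> is the order isomorphism from \<open>'r\<close> to \<open>{1..r}\<close>.
\<close>

definition pos :: "'r::{finite,linorder} \<Rightarrow> nat" where
  "pos i = card {..i}"

lemma pos_strict_mono: "i < j \<Longrightarrow> pos i < pos j"
  unfolding pos_def by (rule psubset_card_mono) auto

lemma bij_betw_pos: "bij_betw pos (UNIV :: 'r::{finite,linorder} set) {1..CARD('r)}"
proof -
  have inj: "inj (pos :: 'r \<Rightarrow> nat)"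
    by (rule injI) (metis linorder_neqE less_irrefl pos_strict_mono)
  have "1 \<le> pos i" for i :: 'r
    using card_mono[of "{..i}" "{i}"] by (simp add: pos_def)
  moreover have "pos i \<le> CARD('r)" for i :: 'r
    unfolding pos_def by (rule card_mono) auto
  ultimately have "range (pos :: 'r \<Rightarrow> nat) \<subseteq> {1..CARD('r)}"
    by auto
  then have "range (pos :: 'r \<Rightarrow> nat) = {1..CARD('r)}"
    by (rule card_subset_eq[rotated]) (simp_all add: card_image inj)
  with inj show ?thesis
    by (simp add: bij_betw_def)
qed

definition init_prod :: "complex ^ 'r::{finite,linorder} \<Rightarrow> nat \<Rightarrow> complex" where
  "init_prod z k = (\<Prod>j | pos j \<le> k. z $ j)"

definition init_sum :: "complex ^ 'r::{finite,linorder} \<Rightarrow> nat \<Rightarrow> complex" where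
  "init_sum s k = (\<Sum>j | pos j \<le> k. s $ j)"

definition q_index :: "complex ^ 'r::{finite,linorder} \<Rightarrow> nat" where
  "q_index z =
     (if \<exists>q\<in>{1..CARD('r)}. init_prod z q \<noteq> 1
      then LEAST q. q \<in> {1..CARD('r)} \<and> init_prod z q \<noteq> 1
      else CARD('r) + 1)"

definition U_dom :: "complex ^ 'r::{finite,linorder} \<Rightarrow> (complex ^ 'r::{finite,linorder}) set" where
  "U_dom z =
     {s. (\<forall>i. 1 \<le> i \<and> i < q_index z \<longrightarrow> Re (init_sum s i) > real i) \<and>
         (\<forall>i. q_index z \<le> i \<and> i \<le> CARD('r) \<longrightarrow> Re (init_sum s i) > real i - 1)}"

lemma open_U_dom: "open (U_dom z)" for z :: "complex ^ 'r::{finite,linorder}"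
proof -
  have op: "open {s :: complex ^ 'r::{finite,linorder}. Re (init_sum s i) > a}" for i a
    unfolding init_sum_def by (intro open_Collect_less continuous_intros)
  have "U_dom z = (\<Inter>i\<in>{1..<q_index z}. {s. Re (init_sum s i) > real i}) \<inter>
                  (\<Inter>i\<in>{q_index z..CARD('r)}. {s. Re (init_sum s i) > real i - 1})"
    unfolding U_dom_def by auto
  also have "open \<dots>"
    by (intro open_Int open_INT ballI op) auto
  finally show ?thesis .
qed

definition multi_indices :: "nat \<Rightarrow> ('r::{finite,linorder} \<Rightarrow> nat) set" where
  "multi_indices N = {n. (\<forall>i j. i < j \<longrightarrow> n i > n j) \<and> (\<forall>i. 0 < n i \<and> n i < N)}"

lemma finite_multi_indices: "finite (multi_indices N :: ('r::{finite,linorder} \<Rightarrow> nat) set)"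
proof (rule finite_subset)
  show "multi_indices N \<subseteq> (PiE UNIV (\<lambda>_. {..<N}) :: ('r \<Rightarrow> nat) set)"
    by (auto simp: multi_indices_def PiE_def)
  show "finite (PiE UNIV (\<lambda>_. {..<N}) :: ('r \<Rightarrow> nat) set)"
    by (rule finite_PiE) auto
qed

definition polylog_term ::
    "complex ^ 'r::{finite,linorder} \<Rightarrow> complex ^ 'r::{finite,linorder} \<Rightarrow> ('r \<Rightarrow> nat) \<Rightarrow> complex" where
  "polylog_term z s n = (\<Prod>i\<in>UNIV. z $ i ^ n i) / (\<Prod>i\<in>UNIV. of_nat (n i) powr (s $ i))"

definition polylog_partial ::
    "complex ^ 'r::{finite,linorder} \<Rightarrow> complex ^ 'r::{finite,linorder} \<Rightarrow> nat \<Rightarrow> complex" where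
  "polylog_partial z s N = (\<Sum>n\<in>multi_indices N. polylog_term z s n)"

text \<open>
  Holomorphy in several variables: Frechet differentiability with a complex-linear derivative.
  Additivity and boundedness of \<open>D\<close> are part of \<open>has_derivative\<close>.
\<close>

definition several_holomorphic_on ::
    "(complex ^ 'r::finite \<Rightarrow> complex) \<Rightarrow> (complex ^ 'r) set \<Rightarrow> bool" where
  "several_holomorphic_on f U \<longleftrightarrow>
     (\<forall>s\<in>U. \<exists>D. (f has_derivative D) (at s within U) \<and> (\<forall>c h. D (c *s h) = c * D h))"

end

theory Submission
  imports Defs "HOL-Complex_Analysis.Cauchy_Integral_Formula"
begin

text \<open>
  For \<open>M \<le> N\<close> the difference of the partial sums at \<open>N\<close> and \<open>M\<close> is \<open>T\<^sub>r(0)\<close>, where \<open>T\<^sub>0(n) = 1\<close> for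
  \<open>n \<ge> M\<close>, \<open>T\<^sub>0(n) = 0\<close> for \<open>n < M\<close>, and \<open>T\<^sub>k(m)\<close> is the sum of \<open>z\<^sub>k\<^sup>n n\<^sup>-\<^sup>s T\<^sub>k\<^sub>-\<^sub>1(n)\<close> over \<open>m < n < N\<close>, with
  \<open>s = s\<^sub>k\<close>. Starting from the trivial bound of \<open>T\<^sub>0(n)\<close> by \<open>(n / M)\<close> to a small power \<open>d\<close>, each
  absolute summation raises the exponent of \<open>m\<close> in the bound of \<open>T\<^sub>k(m)\<close> by \<open>1 - Re s\<^sub>k\<close>. At
  \<open>k = q\<close> one has \<open>z\<^sub>q \<noteq> 1\<close>, and summation by parts against the bounded geometric sums raises it by
  \<open>- Re s\<^sub>q\<close> only, which is where the weaker hypotheses from \<open>q\<close> on come from. The factor \<open>M\<close> to the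
  power \<open>-d\<close> survives, so the partial sums are uniformly Cauchy near every point of the domain.
  By Cauchy's inequality on complex lines the derivatives are uniformly Cauchy as well, so the
  limit is differentiable with complex-linear derivative.
\<close>

subsection \<open>Power sums and summation by parts\<close>

lemma norm_of_nat_powr: "norm (of_nat n powr s :: complex) = real n powr Re s" if "n > 0"
  using norm_powr_real_powr[of "of_nat n" s] that by simp

text \<open>Compares powers at x and y up to a constant, whatever the sign of the exponent. The
  constant depends only on the absolute value of a, so it stays uniform over bounded
  exponents.\<close>

lemma powr_le_two_powr:
  fixes x y a :: real
  assumes "0 < y" "y \<le> x" "x \<le> 2 * y"
  shows "x powr a \<le> 2 powr \<bar>a\<bar> * y powr a"
proof -
  have x: "x = (x / y) * y" using assms by simp
  have "(x / y) powr a \<le> (x / y) powr \<bar>a\<bar>"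
    using assms by (intro powr_mono) auto
  also have "\<dots> \<le> 2 powr \<bar>a\<bar>"
    using assms by (intro powr_mono2) (auto simp: field_simps)
  finally have "(x / y) powr a * y powr a \<le> 2 powr \<bar>a\<bar> * y powr a"
    by (intro mult_right_mono) auto
  moreover have "x powr a = (x / y) powr a * y powr a"
    using assms by (simp add: powr_divide)
  ultimately show ?thesis by simp
qed

text \<open>Mean value inequality on the segment from n to n + 1, on which all powers are comparable
  with those of n. The constant involves s only through R; this is what keeps the later estimates
  uniform in s.\<close>

lemma powr_difference_bound:
  fixes s :: complex
  assumes n: "n > 0" and s: "norm s \<le> R"
  shows "norm (of_nat (Suc n) powr (-s) - of_nat n powr (-s))
           \<le> R * 2 powr (R + 1) * real n powr (- Re s - 1)"
proof -
  let ?S = "closed_segment (of_nat n) (of_nat (Suc n)) :: complex set"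
  have S: "\<exists>x. y = of_real x \<and> real n \<le> x \<and> x \<le> real (Suc n)" if "y \<in> ?S" for y
  proof -
    have "?S = of_real ` closed_segment (real n) (real (Suc n))"
      by (metis closed_segment_of_real of_real_of_nat_eq)
    with that show ?thesis by (auto simp: closed_segment_eq_real_ivl)
  qed
  have "norm (of_nat (Suc n) powr (-s) - of_nat n powr (-s))
      \<le> (R * 2 powr (R + 1) * real n powr (- Re s - 1)) * norm (of_nat (Suc n) - of_nat n :: complex)"
  proof (rule field_differentiable_bound[where S = ?S and f' = "\<lambda>y. -s * y powr (-s - 1)"])
    show "((\<lambda>y. y powr (-s)) has_field_derivative -s * y powr (-s - 1)) (at y within ?S)"
      if "y \<in> ?S" for y
    proof -
      have "y \<notin> \<real>\<^sub>\<le>\<^sub>0" using S[OF that] n by auto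
      then show ?thesis
        by (intro has_field_derivative_powr has_field_derivative_at_within)
    qed
    show "norm (-s * y powr (-s - 1)) \<le> R * 2 powr (R + 1) * real n powr (- Re s - 1)"
      if "y \<in> ?S" for y
    proof -
      obtain x where x: "y = of_real x" "real n \<le> x" "x \<le> real (Suc n)" using S \<open>y \<in> ?S\<close> by blast
      have "norm (y powr (-s - 1)) = x powr (- Re s - 1)"
        using norm_powr_real_powr[of y "-s - 1"] x n by auto
      also have "\<dots> \<le> 2 powr \<bar>- Re s - 1\<bar> * real n powr (- Re s - 1)"
        using x n by (intro powr_le_two_powr) auto
      also have "\<dots> \<le> 2 powr (R + 1) * real n powr (- Re s - 1)"
        using abs_Re_le_cmod[of s] s by (intro mult_right_mono powr_mono) auto
      finally show ?thesis
        unfolding norm_mult norm_minus_cancel mult.assoc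
        using s order_trans[OF norm_ge_zero s] by (intro mult_mono) auto
    qed
  qed auto
  then show ?thesis by (simp add: algebra_simps)
qed

text \<open>By the mean value theorem the summand at n is at most the drop of x^(-e) / e from n - 1
  to n, and these drops telescope. Weakening 1 / e to 1 / d makes the bound uniform over all e >=
  d.\<close>

lemma sum_powr_tail_bound:
  fixes d e :: real
  assumes "0 < d" "d \<le> e" "m > 0"
  shows "(\<Sum>n\<in>{m<..<N}. real n powr (-1 - e)) \<le> real m powr (-e) / d"
proof -
  have e: "e > 0" using assms by simp
  have tail_step: "real (Suc n) powr (-1 - e) \<le> (real n powr (-e) - real (Suc n) powr (-e)) / e"
    if n: "n > 0" for n
  proof -
    have "\<exists>\<xi>. real n < \<xi> \<and> \<xi> < real (Suc n) \<and>
        real (Suc n) powr (-e) - real n powr (-e) = (real (Suc n) - real n) * (-e * \<xi> powr (-e - 1))"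
      using n by (intro MVT2) (auto intro!: derivative_eq_intros has_real_derivative_powr)
    then obtain \<xi> where \<xi>: "real n < \<xi>" "\<xi> < real (Suc n)"
      "real n powr (-e) - real (Suc n) powr (-e) = e * \<xi> powr (-e - 1)"
      by (auto simp: algebra_simps)
    have "real (Suc n) powr (-1 - e) \<le> \<xi> powr (-1 - e)"
      using \<xi> n e by (intro powr_mono2') auto
    also have "\<dots> = (real n powr (-e) - real (Suc n) powr (-e)) / e"
      using \<xi> e by (simp add: minus_diff_commute)
    finally show ?thesis .
  qed
  \<comment> \<open>The subtracted end value is kept so that the induction closes; it is discarded
    afterwards.\<close>
  have tel: "(\<Sum>n\<in>{m<..<N}. real n powr (-1 - e)) \<le> (real m powr (-e) - real N' powr (-e)) / e"
    if "N = Suc N'" "m \<le> N'" for N'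
    using that(2) unfolding that(1)
  proof (induction N' rule: dec_induct)
    case base
    have "{m<..<Suc m} = {}" by auto
    then show ?case by simp
  next
    case (step k)
    have "{m<..<Suc (Suc k)} = insert (Suc k) {m<..<Suc k}" using step by auto
    then show ?case using step assms(3) tail_step[of k]
      by (simp add: diff_divide_distrib)
  qed
  have "(\<Sum>n\<in>{m<..<N}. real n powr (-1 - e)) \<le> real m powr (-e) / e"
  proof (cases "m < N")
    case True
    then show ?thesis
      using e by (intro order_trans[OF tel[of "N - 1"]]) (auto intro!: divide_right_mono)
  qed (use e in auto)
  also have "\<dots> \<le> real m powr (-e) / d"
    using assms by (intro divide_left_mono) auto
  finally show ?thesis .
qed

text \<open>Summation by parts with the factor 1 - w on the left: no division occurs and the partial
  geometric sums need not be named.\<close>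

lemma abel_geometric_identity:
  fixes a :: "nat \<Rightarrow> 'a::comm_ring_1"
  assumes "p \<le> L"
  shows "(1 - w) * (\<Sum>n=p..L. w ^ n * a n) =
    w ^ p * a p - w ^ Suc L * a L + (\<Sum>n=p..<L. w ^ Suc n * (a (Suc n) - a n))"
  using assms
proof (induction L rule: dec_induct)
  case base
  then show ?case by (simp add: algebra_simps)
next
  case (step L)
  then show ?case by (simp add: algebra_simps)
qed

text \<open>The initial value \<open>a p\<close> is traded for \<open>a L\<close> plus the total
  variation, which accounts for the factor 2. Only the boundary term at L remains, and in
  \<open>abel_step\<close> it vanishes.\<close>

lemma abel_geometric_bound:
  fixes a :: "nat \<Rightarrow> complex"
  assumes w: "norm w \<le> 1" "w \<noteq> 1" and pL: "p \<le> L"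
  shows "norm (\<Sum>n=p..L. w ^ n * a n)
           \<le> 2 / norm (1 - w) * (norm (a L) + (\<Sum>n=p..<L. norm (a (Suc n) - a n)))"
proof -
  let ?V = "\<Sum>n=p..<L. norm (a (Suc n) - a n)"
  have pw: "norm (w ^ n * y) \<le> norm y" for n and y :: complex
    using w by (simp add: norm_mult norm_power mult_left_le_one_le power_le_one)
  have "a L - a p = (\<Sum>n=p..<L. a (Suc n) - a n)"
    using pL by (simp add: sum_Suc_diff')
  then have "norm (a p) \<le> norm (a L) + ?V"
    by (smt (verit) norm_sum norm_triangle_ineq3 norm_minus_commute sum.cong)
  moreover have "norm ((1 - w) * (\<Sum>n=p..L. w ^ n * a n)) \<le> norm (a p) + norm (a L) + ?V"
    unfolding abel_geometric_identity[OF pL]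
    by (intro order_trans[OF norm_triangle_ineq] order_trans[OF norm_triangle_ineq4] add_mono
          order_trans[OF norm_sum] sum_mono pw)
  ultimately have "norm (1 - w) * norm (\<Sum>n=p..L. w ^ n * a n) \<le> 2 * (norm (a L) + ?V)"
    by (simp add: norm_mult)
  then show ?thesis using w by (simp add: field_simps)
qed

text \<open>The oscillation of w^n is ignored, so one summation costs a full power of n. The margin
  d keeps the exponent of the summand at or below -1 - d, which yields the factor 1 / d.\<close>

lemma absolute_step:
  fixes g :: "nat \<Rightarrow> complex"
  assumes g: "\<And>n. n > 0 \<Longrightarrow> norm (g n) \<le> C * real n powr \<beta>"
    and w: "norm w \<le> 1" and C: "0 \<le> C" and d: "0 < d" "\<beta> + 1 + d \<le> Re s" and m: "m > 0"
  shows "norm (\<Sum>n\<in>{m<..<N}. w ^ n / of_nat n powr s * g n)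
           \<le> C / d * real m powr (\<beta> + 1 - Re s)"
proof -
  have "norm (\<Sum>n\<in>{m<..<N}. w ^ n / of_nat n powr s * g n)
          \<le> (\<Sum>n\<in>{m<..<N}. C * real n powr (-1 - (Re s - \<beta> - 1)))"
  proof (rule sum_norm_le)
    fix n assume "n \<in> {m<..<N}"
    then have n: "n > 0" using m by auto
    have "norm (w ^ n / of_nat n powr s * g n) = norm w ^ n * (real n powr (- Re s) * norm (g n))"
      using n by (simp add: norm_mult norm_divide norm_power norm_of_nat_powr powr_minus_divide)
    also have "\<dots> \<le> 1 * (real n powr (- Re s) * (C * real n powr \<beta>))"
      using w by (intro mult_mono g n power_le_one) auto
    also have "\<dots> = C * real n powr (-1 - (Re s - \<beta> - 1))"
      by (simp add: powr_add[symmetric])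
    finally show "norm (w ^ n / of_nat n powr s * g n) \<le> C * real n powr (-1 - (Re s - \<beta> - 1))" .
  qed
  also have "\<dots> \<le> C * (real m powr (- (Re s - \<beta> - 1)) / d)"
    unfolding sum_distrib_left[symmetric]
    using d m C by (intro mult_left_mono sum_powr_tail_bound) auto
  finally show ?thesis by (simp add: algebra_simps)
qed

text \<open>Differencing gains a power of n in both factors of n^(-s) g(n): in the first by
  \<open>powr_difference_bound\<close>, in the second by \<open>dg\<close>. Summing the differences
  then costs that power back, so in total the exponent changes by - Re s only.\<close>

lemma abel_step:
  fixes g :: "nat \<Rightarrow> complex"
  assumes g: "\<And>n. n > 0 \<Longrightarrow> norm (g n) \<le> C * real n powr \<beta>"
    and dg: "\<And>n. n > 0 \<Longrightarrow> norm (g (Suc n) - g n) \<le> C' * real n powr (\<beta> - 1)"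
    and gN: "g N = 0" and \<beta>: "\<beta> \<le> 0"
    and w: "norm w \<le> 1" "w \<noteq> 1" and C: "0 \<le> C" "0 \<le> C'"
    and d: "0 < d" "\<beta> + d \<le> Re s" and s: "norm s \<le> R" and m: "m > 0"
  shows "norm (\<Sum>n\<in>{m<..<N}. w ^ n / of_nat n powr s * g n)
           \<le> 2 / norm (1 - w) * ((R * 2 powr (R + 1) * C + C') / d) * real m powr (\<beta> - Re s)"
proof (cases "m < N")
  case False
  then show ?thesis using C d order_trans[OF norm_ge_zero s] by auto
next
  case True
  define K where "K = R * 2 powr (R + 1) * C + C'"
  define a where "a n = of_nat n powr (- s) * g n" for n
  have R: "0 \<le> R" using order_trans[OF norm_ge_zero s] .
  have K: "K \<ge> 0" using R C by (simp add: K_def)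
  have da: "norm (a (Suc n) - a n) \<le> K * real n powr (-1 - (Re s - \<beta>))" if n: "n > 0" for n
  proof -
    have "a (Suc n) - a n = (of_nat (Suc n) powr (-s) - of_nat n powr (-s)) * g (Suc n)
        + of_nat n powr (-s) * (g (Suc n) - g n)"
      by (simp add: a_def algebra_simps)
    also have "norm \<dots> \<le> norm (of_nat (Suc n) powr (-s) - of_nat n powr (-s)) * norm (g (Suc n))
        + norm (of_nat n powr (-s)) * norm (g (Suc n) - g n)"
      by (metis norm_mult norm_triangle_ineq)
    also have "\<dots> \<le> (R * 2 powr (R + 1) * real n powr (- Re s - 1)) * (C * real n powr \<beta>)
        + real n powr (- Re s) * (C' * real n powr (\<beta> - 1))"
    proof (intro add_mono mult_mono dg n powr_difference_bound s)
      have "norm (g (Suc n)) \<le> C * real (Suc n) powr \<beta>" by (intro g) simp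
      also have "\<dots> \<le> C * real n powr \<beta>"
        using \<beta> n C by (intro mult_left_mono powr_mono2') auto
      finally show "norm (g (Suc n)) \<le> C * real n powr \<beta>" .
    qed (use R n in \<open>auto simp: norm_of_nat_powr\<close>)
    also have "\<dots> = R * 2 powr (R + 1) * C * (real n powr (- Re s - 1) * real n powr \<beta>)
        + C' * (real n powr (- Re s) * real n powr (\<beta> - 1))"
      by (simp add: algebra_simps)
    also have "\<dots> = K * real n powr (-1 - (Re s - \<beta>))"
      by (simp add: powr_add[symmetric] K_def algebra_simps)
    finally show ?thesis .
  qed
  have "(\<Sum>n\<in>{m<..<N}. w ^ n / of_nat n powr s * g n) = (\<Sum>n=Suc m..N. w ^ n * a n)"
  proof -
    have "(\<Sum>n\<in>{m<..<N}. w ^ n / of_nat n powr s * g n) = (\<Sum>n\<in>{m<..<N}. w ^ n * a n)"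
      by (intro sum.cong) (simp_all add: a_def powr_minus_divide)
    \<comment> \<open>The term at n = N is zero because \<open>g N = 0\<close>. Including it makes N
      the upper end, where the boundary term of the Abel bound vanishes.\<close>
    also have "\<dots> = (\<Sum>n=Suc m..N. w ^ n * a n)"
    proof (rule sum.mono_neutral_left)
      show "\<forall>i\<in>{Suc m..N} - {m<..<N}. w ^ i * a i = 0"
      proof
        fix i assume "i \<in> {Suc m..N} - {m<..<N}"
        then have "i = N" by auto
        then show "w ^ i * a i = 0" using gN by (simp add: a_def)
      qed
    qed auto
    finally show ?thesis .
  qed
  also have "norm \<dots> \<le> 2 / norm (1 - w) * (norm (a N) + (\<Sum>n=Suc m..<N. norm (a (Suc n) - a n)))"
    using w True by (intro abel_geometric_bound) auto
  also have "norm (a N) = 0" using gN by (simp add: a_def)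
  also have "(\<Sum>n=Suc m..<N. norm (a (Suc n) - a n)) \<le> (\<Sum>n\<in>{m<..<N}. K * real n powr (-1 - (Re s - \<beta>)))"
    unfolding atLeastSucLessThan_greaterThanLessThan by (intro sum_mono da) auto
  also have "\<dots> \<le> K * (real m powr (- (Re s - \<beta>)) / d)"
    unfolding sum_distrib_left[symmetric]
    using d m K by (intro mult_left_mono sum_powr_tail_bound) auto
  finally show ?thesis unfolding K_def[symmetric]
    by (simp add: divide_right_mono mult_left_mono algebra_simps)
qed

text \<open>The case q = 1 needs its own argument: the indicator of n >= M jumps by 1 at M and need
  not vanish at N, so \<open>abel_step\<close> does not apply to it. Instead the jump is absorbed
  into the starting point p of the sum.\<close>

lemma abel_first_step:
  assumes w: "norm w \<le> 1" "w \<noteq> 1"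
    and d: "0 < d" "2 * d \<le> Re s" and s: "norm s \<le> R" and m: "m > 0" and M: "M > 0"
  shows "norm (\<Sum>n\<in>{m<..<N}. w ^ n / of_nat n powr s * (if M \<le> n then 1 else 0))
           \<le> 2 / norm (1 - w) * (1 + R * 2 powr (R + 1) * (1 + 1 / d))
              * (real m powr (d - Re s) * real M powr (- d))"
proof -
  define p where "p = max (Suc m) M"
  define K where "K = R * 2 powr (R + 1)"
  have R: "0 \<le> R" using order_trans[OF norm_ge_zero s] .
  have K: "K \<ge> 0" using R by (simp add: K_def)
  have \<sigma>: "Re s > 0" using d by simp
  have "(\<Sum>n\<in>{m<..<N}. w ^ n / of_nat n powr s * (if M \<le> n then 1 else 0))
      = (\<Sum>n\<in>{p..<N}. w ^ n * of_nat n powr (- s))"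
  proof (rule sum.mono_neutral_cong_right)
    show "\<forall>i\<in>{m<..<N} - {p..<N}. w ^ i / of_nat i powr s * (if M \<le> i then 1 else 0) = 0"
      by (auto simp: p_def)
  qed (auto simp: p_def powr_minus_divide)
  also have "norm \<dots> \<le> 2 / norm (1 - w) * ((1 + K * (1 + 1 / d)) * real p powr (- Re s))"
  proof (cases "p < N")
    case False
    then show ?thesis using K d by auto
  next
    case True
    define L where "L = N - 1"
    have L: "p \<le> L" "{p..<N} = {p..L}" using True by (auto simp: L_def)
    have p: "p > 0" by (simp add: p_def)
    have "norm (\<Sum>n\<in>{p..<N}. w ^ n * of_nat n powr (- s))
        \<le> 2 / norm (1 - w) * (norm (of_nat L powr (-s)) +
            (\<Sum>n=p..<L. norm (of_nat (Suc n) powr (-s) - of_nat n powr (-s))))"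
      unfolding L(2) using w L(1) by (rule abel_geometric_bound)
    also have "\<dots> \<le> 2 / norm (1 - w) * (real p powr (- Re s) + K * (1 + 1 / d) * real p powr (- Re s))"
    proof (intro mult_left_mono add_mono)
      show "norm (of_nat L powr (-s)) \<le> real p powr (- Re s)"
        using L p \<sigma> by (auto simp: norm_of_nat_powr intro!: powr_mono2')
      have "(\<Sum>n=p..<L. norm (of_nat (Suc n) powr (-s) - of_nat n powr (-s)))
          \<le> (\<Sum>n=p..<L. K * real n powr (-1 - Re s))"
      proof (rule sum_mono)
        fix n assume "n \<in> {p..<L}"
        then show "norm (of_nat (Suc n) powr (-s) - of_nat n powr (-s)) \<le> K * real n powr (-1 - Re s)"
          using powr_difference_bound[OF _ s, of n] p
          unfolding K_def minus_diff_commute[of "Re s" 1] by simp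
      qed
      \<comment> \<open>The tail bound covers only n > p, so the term at p is split off; it supplies
        the 1 in 1 + 1 / d. For p = L the new index set is larger than the old one, hence the
        inequality.\<close>
      also have "\<dots> \<le> (\<Sum>n\<in>insert p {p<..<L}. K * real n powr (-1 - Re s))"
        using K by (intro sum_mono2) auto
      also have "\<dots> = K * (real p powr (-1 - Re s) + (\<Sum>n\<in>{p<..<L}. real n powr (-1 - Re s)))"
        by (simp add: sum_distrib_left distrib_left)
      also have "\<dots> \<le> K * (real p powr (- Re s) + real p powr (- Re s) / d)"
        using K p d by (intro mult_left_mono add_mono sum_powr_tail_bound powr_mono) auto
      finally show "(\<Sum>n=p..<L. norm (of_nat (Suc n) powr (-s) - of_nat n powr (-s)))
          \<le> K * (1 + 1 / d) * real p powr (- Re s)" by (simp add: algebra_simps)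
    qed auto
    finally show ?thesis by (simp add: algebra_simps)
  qed
  also have "\<dots> \<le> 2 / norm (1 - w) * ((1 + K * (1 + 1 / d)) * (real m powr (d - Re s) * real M powr (- d)))"
  proof -
    \<comment> \<open>Since p is at least m and at least M, one factor can be spent on decay in m
      and the other on decay in M.\<close>
    have "real p powr (- Re s) = real p powr (d - Re s) * real p powr (- d)"
      by (simp add: powr_add[symmetric])
    also have "\<dots> \<le> real m powr (d - Re s) * real M powr (- d)"
      using d m M by (intro mult_mono powr_mono2') (auto simp: p_def)
    finally show ?thesis using K d by (intro mult_left_mono) auto
  qed
  finally show ?thesis by (simp only: K_def mult.assoc)
qed

subsection \<open>Bounds for iterated tail sums\<close>

text \<open>Level k sums over N > n_1 > ... > n_k > m, with the smallest index outermost. The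
  function g weights the largest index n_1: the constant 1 gives the partial sums, while
  \<open>tail_from M\<close> keeps only the chains with n_1 >= M.\<close>

fun nested_sum :: "(nat \<Rightarrow> complex) \<Rightarrow> (nat \<Rightarrow> complex) \<Rightarrow> (nat \<Rightarrow> complex) \<Rightarrow> nat \<Rightarrow> nat \<Rightarrow> nat \<Rightarrow> complex"
  where
    "nested_sum w u g N 0 m = g m"
  | "nested_sum w u g N (Suc k) m =
       (\<Sum>n\<in>{m<..<N}. w (Suc k) ^ n / of_nat n powr u (Suc k) * nested_sum w u g N k n)"

text \<open>
  In \<open>region\<close> and \<open>tail_exponent\<close>, the margin \<open>2 * d\<close> is split in two halves: one is lost to the
  decay in \<open>M\<close>, the other keeps the tail sums convergent.
\<close>

definition abscissa :: "nat \<Rightarrow> nat \<Rightarrow> real" where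
  "abscissa q k = real (if k < q then k else k - 1)"

definition region :: "nat \<Rightarrow> nat \<Rightarrow> real \<Rightarrow> real \<Rightarrow> (nat \<Rightarrow> complex) set" where
  "region r q d R = {u. \<forall>k\<in>{1..r}. norm (u k) \<le> R \<and> abscissa q k + 2 * d \<le> (\<Sum>j=1..k. Re (u j))}"

definition tail_exponent :: "nat \<Rightarrow> real \<Rightarrow> (nat \<Rightarrow> complex) \<Rightarrow> nat \<Rightarrow> real" where
  "tail_exponent q d u k = abscissa q k - (\<Sum>j=1..k. Re (u j)) + d"

abbreviation tail_from :: "nat \<Rightarrow> nat \<Rightarrow> complex" where
  "tail_from M \<equiv> \<lambda>n. if M \<le> n then 1 else 0"

lemma nested_sum_Suc_diff:
  "nested_sum w u g N (Suc k) (Suc m) - nested_sum w u g N (Suc k) m =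
     - (if Suc m < N then w (Suc k) ^ Suc m / of_nat (Suc m) powr u (Suc k) * nested_sum w u g N k (Suc m)
        else 0)"
proof (cases "Suc m < N")
  case True
  then have "{m<..<N} = insert (Suc m) {Suc m<..<N}" by auto
  with True show ?thesis by (simp del: of_nat_Suc power_Suc)
next
  case False
  then have "{m<..<N} = {}" "{Suc m<..<N} = {}" by auto
  with False show ?thesis by simp
qed

text \<open>Raising m by one removes a single term, so the difference is controlled by the level
  below without any summation. This is the gain of one power that \<open>abel_step\<close> demands
  of g.\<close>

lemma norm_nested_sum_Suc_diff_le:
  assumes "norm (w (Suc k)) \<le> 1"
  shows "norm (nested_sum w u g N (Suc k) (Suc m) - nested_sum w u g N (Suc k) m)
    \<le> real (Suc m) powr (- Re (u (Suc k))) * norm (nested_sum w u g N k (Suc m))"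
proof -
  have "norm (w (Suc k)) ^ Suc m \<le> 1" using assms by (intro power_le_one) auto
  then show ?thesis
    unfolding nested_sum_Suc_diff norm_minus_cancel
    by (auto simp: norm_mult norm_divide norm_power norm_of_nat_powr powr_minus_divide
          simp del: of_nat_Suc power_Suc intro!: mult_left_le_one_le divide_right_mono)
qed

text \<open>One constant serves all u in the region and all M, N and m. The statement is named
  because the induction draws on it at two different levels.\<close>

definition nested_sum_bounded where
  "nested_sum_bounded w r q d R k C \<longleftrightarrow> C \<ge> 0 \<and> (\<forall>u\<in>region r q d R. \<forall>M>0. \<forall>N. \<forall>m>0.
     norm (nested_sum w u (tail_from M) N k m)
       \<le> C * real M powr (- d) * real m powr tail_exponent q d u k)"

lemma nested_sum_boundedD:
  assumes "nested_sum_bounded w r q d R k C"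
  shows "C \<ge> 0"
    and "\<lbrakk>u \<in> region r q d R; M > 0; m > 0\<rbrakk> \<Longrightarrow>
      norm (nested_sum w u (tail_from M) N k m)
        \<le> C * real M powr (- d) * real m powr tail_exponent q d u k"
  using assms by (simp_all add: nested_sum_bounded_def)

text \<open>Strong induction, since the step at k = q uses level q - 1 for the size of the summand
  and level q - 2 for its differences. The other steps use \<open>absolute_step\<close> and the
  level just below.\<close>

lemma nested_sum_bound:
  fixes w :: "nat \<Rightarrow> complex"
  assumes w: "\<And>k. norm (w k) \<le> 1" and q: "q \<ge> 1" "q \<le> r \<Longrightarrow> w q \<noteq> 1" and d: "d > 0"
  shows "k \<le> r \<Longrightarrow> \<exists>C. nested_sum_bounded w r q d R k C"
proof (induction k rule: less_induct)
  case (less k)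
  show ?case
  proof (cases k)
    case 0
    show ?thesis unfolding 0 nested_sum_bounded_def
    proof (intro exI[of _ 1] conjI allI ballI impI)
      fix u and M N m :: nat assume M: "M > 0" and m: "m > 0"
      have "1 \<le> real M powr (- d) * real m powr d" if "M \<le> m"
        using that M d by (simp add: powr_minus field_simps powr_mono2)
      then show "norm (nested_sum w u (tail_from M) N 0 m)
          \<le> 1 * real M powr (- d) * real m powr tail_exponent q d u 0"
        using q by (simp add: tail_exponent_def abscissa_def)
    qed auto
  next
    case (Suc l)
    then have l: "l < k" "l \<le> r" using less.prems by auto
    obtain C where "nested_sum_bounded w r q d R l C"
      using less.IH[OF l] by blast
    note C = nested_sum_boundedD[OF this]
    have reg: "norm (u k) \<le> R" "abscissa q k + 2 * d \<le> (\<Sum>j=1..k. Re (u j))" if "u \<in> region r q d R" for u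
    proof -
      have "k \<in> {1..r}" using less.prems Suc by auto
      with that show "norm (u k) \<le> R" "abscissa q k + 2 * d \<le> (\<Sum>j=1..k. Re (u j))"
        unfolding region_def by blast+
    qed
    have S: "(\<Sum>j=1..k. Re (u j)) = (\<Sum>j=1..l. Re (u j)) + Re (u k)" for u :: "nat \<Rightarrow> complex"
      by (simp add: Suc)
    show ?thesis
    proof (cases "k = q")
      case False
      \<comment> \<open>Away from q the threshold rises by one, which is exactly the cost of an
        absolute summation.\<close>
      then have ab: "abscissa q k = abscissa q l + 1" using q Suc by (auto simp: abscissa_def)
      show ?thesis unfolding nested_sum_bounded_def
      proof (intro exI[of _ "C / d"] conjI allI ballI impI)
        fix u and M N m :: nat assume u: "u \<in> region r q d R" and M: "M > 0" and m: "m > 0"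
        have "norm (nested_sum w u (tail_from M) N k m)
          \<le> (C * real M powr (- d)) / d * real m powr (tail_exponent q d u l + 1 - Re (u k))"
          unfolding Suc nested_sum.simps unfolding Suc[symmetric]
          using reg[OF u] S[of u] ab
          by (intro absolute_step C u M w d m) (auto simp: C(1) tail_exponent_def)
        also have "tail_exponent q d u l + 1 - Re (u k) = tail_exponent q d u k"
          using ab S[of u] by (simp add: tail_exponent_def)
        finally show "norm (nested_sum w u (tail_from M) N k m)
          \<le> C / d * real M powr (- d) * real m powr tail_exponent q d u k" by simp
      qed (use C d in auto)
    next
      case True
      then have wk: "w k \<noteq> 1" using q less.prems by auto
      show ?thesis
      proof (cases l)
        case 0
        have k: "k = 1" using 0 Suc by simp
        have R: "0 \<le> R" if "u \<in> region r q d R" for u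
          using reg(1)[OF that] norm_ge_zero order_trans by blast
        \<comment> \<open>The absolute value keeps the constant nonnegative also for R < 0, when the
          region is empty.\<close>
        let ?C = "2 / norm (1 - w k) * (1 + \<bar>R\<bar> * 2 powr (\<bar>R\<bar> + 1) * (1 + 1 / d))"
        show ?thesis unfolding nested_sum_bounded_def
        proof (intro exI[of _ ?C] conjI allI ballI impI)
          fix u and M N m :: nat assume u: "u \<in> region r q d R" and M: "M > 0" and m: "m > 0"
          have "norm (nested_sum w u (tail_from M) N k m)
            \<le> ?C * (real m powr (d - Re (u k)) * real M powr (- d))"
            unfolding k nested_sum.simps One_nat_def using reg[OF u] wk R[OF u]
            by (intro abel_first_step w d M m) (auto simp: k True[symmetric] abscissa_def)
          also have "d - Re (u k) = tail_exponent q d u k"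
            by (simp add: k True[symmetric] tail_exponent_def abscissa_def)
          finally show "norm (nested_sum w u (tail_from M) N k m)
            \<le> ?C * real M powr (- d) * real m powr tail_exponent q d u k"
            by (simp only: mult_ac)
        qed (use d in auto)
      next
        case l': (Suc j)
        \<comment> \<open>Level j = q - 2 controls the differences of level l = q - 1.\<close>
        obtain C' where "nested_sum_bounded w r q d R j C'"
          using less.IH[of j] l l' by auto
        note C' = nested_sum_boundedD[OF this]
        have ab: "abscissa q k = abscissa q l" "abscissa q l = abscissa q j + 1"
          using True l' Suc by (auto simp: abscissa_def)
        let ?C = "2 / norm (1 - w k) * ((\<bar>R\<bar> * 2 powr (\<bar>R\<bar> + 1) * C + C') / d)"
        show ?thesis unfolding nested_sum_bounded_def
        proof (intro exI[of _ ?C] conjI allI ballI impI)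
          fix u and M N m :: nat assume u: "u \<in> region r q d R" and M: "M > 0" and m: "m > 0"
          define D where "D = real M powr (- d)"
          have D: "D \<ge> 0" by (simp add: D_def)
          have R: "\<bar>R\<bar> = R"
            using order_trans[OF norm_ge_zero reg(1)[OF u]] by simp
          have S': "(\<Sum>i=1..l. Re (u i)) = (\<Sum>i=1..j. Re (u i)) + Re (u l)"
            by (simp add: l')
          have "l \<in> {1..r}" using l l' by auto
          then have reg': "abscissa q l + 2 * d \<le> (\<Sum>i=1..l. Re (u i))"
            using u unfolding region_def by blast
          have "norm (nested_sum w u (tail_from M) N k m)
            \<le> 2 / norm (1 - w k) * ((R * 2 powr (R + 1) * (C * D) + C' * D) / d)
                * real m powr (tail_exponent q d u l - Re (u k))"
            unfolding Suc nested_sum.simps unfolding Suc[symmetric]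
          proof (rule abel_step)
            show "norm (nested_sum w u (tail_from M) N l n) \<le> C * D * real n powr tail_exponent q d u l"
              if "n > 0" for n
              unfolding D_def by (intro C u M that)
            show "norm (nested_sum w u (tail_from M) N l (Suc n) - nested_sum w u (tail_from M) N l n)
                \<le> C' * D * real n powr (tail_exponent q d u l - 1)" if n: "n > 0" for n
            proof -
              have "norm (nested_sum w u (tail_from M) N l (Suc n) - nested_sum w u (tail_from M) N l n)
                \<le> real (Suc n) powr (- Re (u l)) * norm (nested_sum w u (tail_from M) N j (Suc n))"
                unfolding l' by (rule norm_nested_sum_Suc_diff_le[OF w])
              also have "\<dots> \<le> real (Suc n) powr (- Re (u l)) * (C' * D * real (Suc n) powr tail_exponent q d u j)"
                unfolding D_def by (intro mult_left_mono C' u M) auto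
              also have "\<dots> = C' * D * real (Suc n) powr (tail_exponent q d u l - 1)"
              proof -
                \<comment> \<open>The threshold rises by one from j to l, but a single dropped term
                  does not pay for a summation; the difference is the required factor 1 / n.\<close>
                have "tail_exponent q d u j - Re (u l) = tail_exponent q d u l - 1"
                  unfolding tail_exponent_def ab S' by simp
                then show ?thesis
                  by (simp add: powr_add[symmetric] add.commute[of "- Re (u l)"] mult.left_commute)
              qed
              also have "\<dots> \<le> C' * D * real n powr (tail_exponent q d u l - 1)"
                using reg' d n C'(1) D
                by (intro mult_left_mono powr_mono2') (auto simp: tail_exponent_def)
              finally show ?thesis .
            qed
            show "nested_sum w u (tail_from M) N l N = 0" by (simp add: l')
            show "tail_exponent q d u l \<le> 0" using reg' d by (simp add: tail_exponent_def)
            show "tail_exponent q d u l + d \<le> Re (u k)"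
              using reg(2)[OF u] S[of u] ab by (simp add: tail_exponent_def)
          qed (use C(1) C'(1) D d m w wk reg(1)[OF u] in auto)
          also have "tail_exponent q d u l - Re (u k) = tail_exponent q d u k"
            using ab S[of u] by (simp add: tail_exponent_def)
          also have "R * 2 powr (R + 1) * (C * D) + C' * D = (R * 2 powr (R + 1) * C + C') * D"
            by (simp add: algebra_simps)
          finally show "norm (nested_sum w u (tail_from M) N k m)
            \<le> ?C * real M powr (- d) * real m powr tail_exponent q d u k"
            unfolding R D_def[symmetric] by (simp add: mult_ac)
        qed (use C(1) C'(1) d in auto)
      qed
    qed
  qed
qed

text \<open>The bounds hold for m > 0 only. The sums at m = 0 and m = 1 differ by the term at n = 1,
  which level r - 1 controls, and at m = 1 every power of m is 1.\<close>

lemma nested_sum_cauchy_bound: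
  fixes w :: "nat \<Rightarrow> complex"
  assumes w: "\<And>k. norm (w k) \<le> 1" and q: "q \<ge> 1" "q \<le> r \<Longrightarrow> w q \<noteq> 1" and d: "d > 0" and r: "r \<ge> 1"
  shows "\<exists>C. \<forall>u\<in>region r q d R. \<forall>M>0. \<forall>N.
    norm (nested_sum w u (tail_from M) N r 0) \<le> C * real M powr (- d)"
proof -
  obtain l where rl: "r = Suc l" using r by (cases r) auto
  obtain C where "nested_sum_bounded w r q d R r C"
    using nested_sum_bound[where w = w and q = q and r = r and k = r and R = R, OF w q d] by auto
  note C = nested_sum_boundedD[OF this]
  obtain C' where "nested_sum_bounded w r q d R l C'"
    using nested_sum_bound[where w = w and q = q and r = r and k = l and R = R, OF w q d] rl by auto
  note C' = nested_sum_boundedD[OF this]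
  show ?thesis
  proof (intro exI[of _ "C + C'"] ballI allI impI)
    fix u and M N :: nat assume u: "u \<in> region r q d R" and M: "M > 0"
    let ?f = "\<lambda>k. nested_sum w u (tail_from M) N k"
    have "norm (?f r 1 - ?f r 0) \<le> real 1 powr (- Re (u r)) * norm (?f l 1)"
      using norm_nested_sum_Suc_diff_le[OF w, where k = l and m = 0] by (simp only: rl One_nat_def)
    then have "norm (?f r 0) \<le> norm (?f r 1) + norm (?f l 1)"
      using norm_triangle_ineq2[of "?f r 0" "?f r 1"] by (simp add: norm_minus_commute)
    also have "\<dots> \<le> C * real M powr (- d) + C' * real M powr (- d)"
      using C(2)[OF u M, of 1] C'(2)[OF u M, of 1] by (intro add_mono) auto
    finally show "norm (?f r 0) \<le> (C + C') * real M powr (- d)" by (simp add: algebra_simps)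
  qed
qed

text \<open>The chains below N that are not chains below M are those with largest index at least M.
  The guard \<open>m < M\<close> matters at level 0, where the sum is 1 for every m; at higher
  levels it agrees with the empty sum.\<close>

lemma nested_sum_diff:
  assumes "M \<le> N"
  shows "nested_sum w u (\<lambda>_. 1) N k m - (if m < M then nested_sum w u (\<lambda>_. 1) M k m else 0)
    = nested_sum w u (tail_from M) N k m"
proof (induction k arbitrary: m)
  case (Suc k)
  let ?c = "\<lambda>n. w (Suc k) ^ n / of_nat n powr u (Suc k)"
  have "(if m < M then nested_sum w u (\<lambda>_. 1) M (Suc k) m else 0)
      = (\<Sum>n\<in>{m<..<M}. ?c n * nested_sum w u (\<lambda>_. 1) M k n)"
    by auto
  also have "\<dots> = (\<Sum>n\<in>{m<..<N}. ?c n * (if n < M then nested_sum w u (\<lambda>_. 1) M k n else 0))"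
    using assms by (intro sum.mono_neutral_cong_left) auto
  finally show ?case
    by (simp add: Suc[symmetric] sum_subtractf[symmetric] right_diff_distrib)
qed auto

subsection \<open>Locally uniform limits of holomorphic functions of several variables\<close>

lemma norm_vector_smult: "norm (c *s h) = norm c * norm h" for h :: "complex ^ 'r::finite"
  by (simp add: norm_vec_def L2_set_def norm_mult power_mult_distrib sum_distrib_left[symmetric] real_sqrt_mult)

lemma bounded_linear_smult_left: "bounded_linear (\<lambda>c. c *s h)" for h :: "complex ^ 'r::finite"
  by (rule bounded_linear_intro[where K = "norm h"])
     (simp_all add: vec_eq_iff algebra_simps norm_vector_smult)

text \<open>On the complex line through x in direction h, f becomes a holomorphic function of one
  variable with derivative \<open>D x h\<close> at 0, to which Cauchy's inequality applies.\<close>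

lemma Cauchy_estimate_direction:
  fixes f :: "complex ^ 'r::finite \<Rightarrow> complex"
  assumes f: "\<And>y. y \<in> ball x \<rho> \<Longrightarrow> (f has_derivative D y) (at y)"
    and lin: "\<And>y c h. y \<in> ball x \<rho> \<Longrightarrow> D y (c *s h) = c * D y h"
    and B: "\<And>y. y \<in> ball x \<rho> \<Longrightarrow> norm (f y) \<le> B" and \<rho>: "\<rho> > 0"
  shows "norm (D x h) \<le> 2 * B / \<rho> * norm h"
proof (cases "h = 0")
  case True
  have "linear (D x)" using f[of x] \<rho> has_derivative_linear by auto
  then show ?thesis using True by (simp add: linear_0)
next
  case False
  \<comment> \<open>Half of the admissible radius, so that the closed disc of radius t is mapped
    into the open ball; this gives the factor 2 in the estimate.\<close>
  define t where "t = \<rho> / (2 * norm h)"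
  have t: "t > 0" using False \<rho> by (simp add: t_def)
  define \<phi> where "\<phi> c = f (x + c *s h)" for c
  have inb: "x + c *s h \<in> ball x \<rho>" if "norm c \<le> t" for c
  proof -
    have "norm (c *s h) \<le> t * norm h"
      unfolding norm_vector_smult using that by (intro mult_right_mono) auto
    also have "\<dots> < \<rho>" using False \<rho> by (simp add: t_def)
    finally show ?thesis by (simp add: dist_norm)
  qed
  have der: "(\<phi> has_field_derivative D (x + c *s h) h) (at c)" if "norm c \<le> t" for c
  proof -
    have "((\<lambda>c. x + c *s h) has_derivative (\<lambda>c. c *s h)) (at c)"
      using bounded_linear_imp_has_derivative[OF bounded_linear_smult_left]
      by (auto intro!: derivative_eq_intros)
    from diff_chain_at[OF this f[OF inb[OF that]]]
    have "(\<phi> has_derivative (\<lambda>a. D (x + c *s h) (a *s h))) (at c)"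
      by (simp add: \<phi>_def[abs_def] o_def)
    then show ?thesis
      by (simp add: has_field_derivative_def lin[OF inb[OF that]] mult_commute_abs)
  qed
  have "norm ((deriv ^^ 1) \<phi> 0) \<le> fact 1 * B / t ^ 1"
  proof (rule Cauchy_inequality)
    show "\<phi> holomorphic_on ball 0 t"
    proof -
      have "\<exists>\<phi>'. (\<phi> has_field_derivative \<phi>') (at c)" if "c \<in> ball 0 t" for c
        using der[of c] that by auto
      then show ?thesis by (simp add: holomorphic_on_open)
    qed
    show "continuous_on (cball 0 t) \<phi>"
      using der by (intro continuous_at_imp_continuous_on ballI DERIV_isCont) auto
    show "norm (\<phi> c) \<le> B" if "norm (0 - c) = t" for c
      unfolding \<phi>_def using that by (intro B inb) auto
  qed (use t in auto)
  moreover have "deriv \<phi> 0 = D x h" using der[of 0] t by (auto intro: DERIV_imp_deriv)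
  ultimately show ?thesis using False by (simp add: t_def field_simps)
qed

text \<open>The Cauchy estimate for f m - f n makes the derivatives uniformly Cauchy, as operators,
  on a smaller ball; differentiation and limit may then be exchanged by
  \<open>has_derivative_sequence\<close>.\<close>

theorem several_holomorphic_on_uniform_limit:
  fixes f :: "nat \<Rightarrow> complex ^ 'r::finite \<Rightarrow> complex"
  assumes U: "open U" and f: "\<And>n. several_holomorphic_on (f n) U"
    and cauchy: "\<And>s. s \<in> U \<Longrightarrow> \<exists>\<rho>>0. uniformly_Cauchy_on (ball s \<rho>) f"
    and g: "\<And>s. s \<in> U \<Longrightarrow> (\<lambda>n. f n s) \<longlonglongrightarrow> g s"
  shows "several_holomorphic_on g U"
  unfolding several_holomorphic_on_def
proof
  fix s assume s: "s \<in> U"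
  obtain \<rho>1 where \<rho>1: "\<rho>1 > 0" "uniformly_Cauchy_on (ball s \<rho>1) f" using cauchy[OF s] by blast
  obtain \<rho>2 where \<rho>2: "\<rho>2 > 0" "ball s \<rho>2 \<subseteq> U" using U s open_contains_ball by blast
  \<comment> \<open>Halving leaves room for a further ball of radius \<open>\<rho>\<close> around
    each point of \<open>?S\<close>, as the Cauchy estimate requires.\<close>
  define \<rho> where "\<rho> = min \<rho>1 \<rho>2 / 2"
  have \<rho>: "\<rho> > 0" using \<rho>1 \<rho>2 by (simp add: \<rho>_def)
  let ?S = "ball s \<rho>"
  have sub: "y \<in> U" "y \<in> ball s \<rho>1" if "x \<in> ?S" "y \<in> ball x \<rho>" for x y
  proof -
    have "dist s y < 2 * \<rho>" using that dist_triangle[of s y x] by simp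
    then show "y \<in> U" "y \<in> ball s \<rho>1" using \<rho>2(2) by (auto simp: \<rho>_def)
  qed
  have SU: "x \<in> U" if "x \<in> ?S" for x using sub[OF that, of x] \<rho> by simp
  define D where "D n x = (SOME D. (f n has_derivative D) (at x) \<and> (\<forall>c h. D (c *s h) = c * D h))" for n x
  have D: "(f n has_derivative D n x) (at x)" "D n x (c *s h) = c * D n x h" if x: "x \<in> U" for n x c h
  proof -
    have "\<exists>D. (f n has_derivative D) (at x within U) \<and> (\<forall>c h. D (c *s h) = c * D h)"
      using f[of n] x unfolding several_holomorphic_on_def by blast
    then have "(f n has_derivative D n x) (at x) \<and> (\<forall>c h. D n x (c *s h) = c * D n x h)"
      unfolding D_def at_within_open[OF x U] by (rule someI_ex)
    then show "(f n has_derivative D n x) (at x)" "D n x (c *s h) = c * D n x h" by blast+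
  qed
  have D_cauchy: "\<exists>N. \<forall>m\<ge>N. \<forall>n\<ge>N. \<forall>x\<in>?S. \<forall>h. norm (D m x h - D n x h) \<le> e * norm h"
    if e: "e > 0" for e
  proof -
    \<comment> \<open>This tolerance becomes e after multiplication by the factor 2 /
      \<open>\<rho>\<close> of the Cauchy estimate.\<close>
    have "e * \<rho> / 2 > 0" using e \<rho> by simp
    then obtain N where N: "\<And>m n x. \<lbrakk>m \<ge> N; n \<ge> N; x \<in> ball s \<rho>1\<rbrakk> \<Longrightarrow> dist (f m x) (f n x) < e * \<rho> / 2"
      using \<rho>1(2) unfolding uniformly_Cauchy_on_def by meson
    have "norm (D m x h - D n x h) \<le> e * norm h" if mn: "m \<ge> N" "n \<ge> N" and x: "x \<in> ?S" for m n x h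
    proof -
      have "norm (D m x h - D n x h) \<le> 2 * (e * \<rho> / 2) / \<rho> * norm h"
      proof (rule Cauchy_estimate_direction[where f = "\<lambda>y. f m y - f n y" and D = "\<lambda>y h. D m y h - D n y h"])
        show "((\<lambda>y. f m y - f n y) has_derivative (\<lambda>h. D m y h - D n y h)) (at y)" if "y \<in> ball x \<rho>" for y
          using sub[OF x that] by (intro has_derivative_diff D)
        show "D m y (c *s h) - D n y (c *s h) = c * (D m y h - D n y h)" if "y \<in> ball x \<rho>" for y c h
          using sub[OF x that] by (simp add: D right_diff_distrib)
        show "norm (f m y - f n y) \<le> e * \<rho> / 2" if "y \<in> ball x \<rho>" for y
          using N[OF mn sub(2)[OF x that]] by (simp add: dist_norm)
      qed (use \<rho> in auto)
      then show ?thesis using \<rho> by simp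
    qed
    then show ?thesis by blast
  qed
  define g' where "g' x h = lim (\<lambda>n. D n x h)" for x h
  have g': "(\<lambda>n. D n x h) \<longlonglongrightarrow> g' x h" if x: "x \<in> ?S" for x h
  proof -
    have "Cauchy (\<lambda>n. D n x h)"
    proof (rule metric_CauchyI)
      fix e :: real assume "e > 0"
      \<comment> \<open>The added 1 avoids a division by zero at h = 0.\<close>
      define e' where "e' = e / 2 / (norm h + 1)"
      have e': "e' > 0" using \<open>e > 0\<close> by (simp add: e'_def add_nonneg_pos)
      obtain N where "\<forall>m\<ge>N. \<forall>n\<ge>N. \<forall>x\<in>?S. \<forall>h. norm (D m x h - D n x h) \<le> e' * norm h"
        using D_cauchy[OF e'] by blast
      moreover have "e' * norm h < e"
      proof -
        have "e' * norm h \<le> e' * (norm h + 1)" using e' by simp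
        also have "\<dots> = e / 2"
        proof -
          have "norm h + 1 \<noteq> 0" using norm_ge_zero[of h] by linarith
          from iffD1[OF nonzero_eq_divide_eq[OF this] e'_def] show ?thesis .
        qed
        finally show ?thesis using \<open>e > 0\<close> by simp
      qed
      ultimately have "\<forall>m\<ge>N. \<forall>n\<ge>N. dist (D m x h) (D n x h) < e"
        using x unfolding dist_norm by (meson order_le_less_trans)
      then show "\<exists>N. \<forall>m\<ge>N. \<forall>n\<ge>N. dist (D m x h) (D n x h) < e" by blast
    qed
    then show ?thesis unfolding g'_def by (simp add: Cauchy_convergent_iff convergent_LIMSEQ_iff)
  qed
  have "\<exists>G. \<forall>x\<in>?S. (\<lambda>n. f n x) \<longlonglongrightarrow> G x \<and> (G has_derivative g' x) (at x within ?S)"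
  proof (rule has_derivative_sequence)
    show "(f n has_derivative D n x) (at x within ?S)" if "x \<in> ?S" for n x
      using D(1)[OF SU[OF that]] by (rule has_derivative_at_withinI)
    show "\<forall>\<^sub>F n in sequentially. \<forall>x\<in>?S. \<forall>h. norm (D n x h - g' x h) \<le> e * norm h" if e: "e > 0" for e
    proof -
      obtain N where N: "\<And>m n x h. \<lbrakk>m \<ge> N; n \<ge> N; x \<in> ?S\<rbrakk> \<Longrightarrow> norm (D m x h - D n x h) \<le> e * norm h"
        using D_cauchy[OF e] by blast
      have "norm (D n x h - g' x h) \<le> e * norm h" if "n \<ge> N" "x \<in> ?S" for n x h
      proof (rule LIMSEQ_le_const2)
        show "(\<lambda>m. norm (D n x h - D m x h)) \<longlonglongrightarrow> norm (D n x h - g' x h)"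
          using that by (intro tendsto_intros g')
        show "\<exists>M. \<forall>m\<ge>M. norm (D n x h - D m x h) \<le> e * norm h"
          using N that by blast
      qed
      then show ?thesis unfolding eventually_sequentially by blast
    qed
    show "s \<in> ?S" using \<rho> by simp
    show "(\<lambda>n. f n s) \<longlonglongrightarrow> g s" by (rule g[OF s])
  qed auto
  then obtain G where G: "\<And>x. x \<in> ?S \<Longrightarrow> (\<lambda>n. f n x) \<longlonglongrightarrow> G x"
    "\<And>x. x \<in> ?S \<Longrightarrow> (G has_derivative g' x) (at x within ?S)" by blast
  have Gg: "G x = g x" if "x \<in> ?S" for x
    using LIMSEQ_unique[OF G(1)[OF that] g[OF SU[OF that]]] .
  have sS: "s \<in> ?S" using \<rho> by simp
  have "(g has_derivative g' s) (at s within ?S)"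
    by (rule has_derivative_transform[OF sS _ G(2)[OF sS]]) (simp add: Gg)
  then have "(g has_derivative g' s) (at s within U)"
    using \<rho> by (simp add: at_within_open[OF sS] has_derivative_at_withinI)
  moreover have "g' s (c *s h) = c * g' s h" for c h
  proof (rule LIMSEQ_unique[OF g'[OF sS]])
    show "(\<lambda>n. D n s (c *s h)) \<longlonglongrightarrow> c * g' s h"
      unfolding D(2)[OF s] by (intro tendsto_intros g' sS)
  qed
  ultimately show "\<exists>D. (g has_derivative D) (at s within U) \<and> (\<forall>c h. D (c *s h) = c * D h)"
    by blast
qed

subsection \<open>Multiple polylogarithms\<close>

text \<open>The inverse of \<open>pos\<close> on 1, ..., r, used to read vectors as sequences. Other
  arguments still give some index, so bounds on all coordinates carry over to all k.\<close>

definition nth_index :: "nat \<Rightarrow> 'r::{finite,linorder}" where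
  "nth_index k = the_inv_into UNIV pos k"

definition initial_indices :: "nat \<Rightarrow> 'r::{finite,linorder} set" where
  "initial_indices k = {j. pos j \<le> k}"

lemma pos_nth_index: "pos (nth_index k :: 'r) = k"
  if "k \<in> {1..CARD('r::{finite,linorder})}"
  using f_the_inv_into_f_bij_betw[OF bij_betw_pos] that by (simp add: nth_index_def)

lemma pos_bounds: "1 \<le> pos i" "pos i \<le> CARD('r)" for i :: "'r::{finite,linorder}"
  using bij_betwE[OF bij_betw_pos[where 'r = 'r]] by auto

lemma pos_less_iff: "pos i < pos j \<longleftrightarrow> i < j"
  using pos_strict_mono[of i j] pos_strict_mono[of j i] by (cases i j rule: linorder_cases) auto

lemma initial_indices_0 [simp]: "initial_indices 0 = {}"
proof -
  have "pos j > 0" for j :: 'a using pos_bounds(1)[of j] by simp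
  then show ?thesis by (simp add: initial_indices_def)
qed

lemma initial_indices_Suc:
  assumes "Suc k \<le> CARD('r::{finite,linorder})"
  shows "initial_indices (Suc k) = insert (nth_index (Suc k)) (initial_indices k :: 'r set)"
    and "nth_index (Suc k) \<notin> (initial_indices k :: 'r set)"
    and "\<And>i :: 'r. i \<in> initial_indices k \<Longrightarrow> i < nth_index (Suc k)"
proof -
  have p: "pos (nth_index (Suc k) :: 'r) = Suc k" using assms by (intro pos_nth_index) auto
  have "i = nth_index (Suc k)" if "pos i = Suc k" for i :: 'r
    using p that by (intro inj_onD[OF bij_betw_imp_inj_on[OF bij_betw_pos]]) simp_all
  then show "initial_indices (Suc k) = insert (nth_index (Suc k)) (initial_indices k :: 'r set)"
    using p unfolding initial_indices_def le_Suc_eq by blast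
  show "nth_index (Suc k) \<notin> (initial_indices k :: 'r set)" using p by (simp add: initial_indices_def)
  show "i < nth_index (Suc k)" if "i \<in> initial_indices k" for i :: 'r
    using that p by (simp add: initial_indices_def pos_less_iff[symmetric])
qed

lemma initial_indices_CARD: "initial_indices CARD('r) = (UNIV :: 'r::{finite,linorder} set)"
  using pos_bounds(2) by (auto simp: initial_indices_def)

lemma init_sum_initial_indices: "init_sum s k = (\<Sum>j\<in>initial_indices k. s $ j)"
  by (simp add: init_sum_def initial_indices_def)

lemma init_prod_initial_indices: "init_prod s k = (\<Prod>j\<in>initial_indices k. s $ j)"
  by (simp add: init_prod_def initial_indices_def)

lemma init_sum_eq: "k \<le> CARD('r) \<Longrightarrow> init_sum s k = (\<Sum>j=1..k. s $ nth_index j)"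
  for s :: "complex ^ 'r::{finite,linorder}"
proof (induction k)
  case 0
  then show ?case by (simp add: init_sum_initial_indices)
next
  case (Suc k)
  then show ?case
    using initial_indices_Suc[OF Suc.prems]
    by (simp add: init_sum_initial_indices add.commute)
qed

text \<open>By minimality the product of the first q - 1 coordinates is 1, so the product of the
  first q coordinates, which is not 1, equals the q-th coordinate itself.\<close>

lemma q_index_ge_1: "q_index z \<ge> 1"
  and nth_q_index_neq_1: "q_index z \<le> CARD('r) \<Longrightarrow> z $ nth_index (q_index z) \<noteq> 1"
  for z :: "complex ^ 'r::{finite,linorder}"
proof -
  define P where "P q \<longleftrightarrow> q \<in> {1..CARD('r)} \<and> init_prod z q \<noteq> 1" for q
  have q: "q_index z = (if Ex P then LEAST q. P q else CARD('r) + 1)"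
    by (simp only: q_index_def P_def[abs_def] Bex_def)
  have Pq: "P (q_index z)" if "Ex P" using LeastI_ex[OF that] that by (simp only: q if_True)
  show "q_index z \<ge> 1"
  proof (cases "Ex P")
    case True
    with Pq show ?thesis by (simp add: P_def)
  next
    case False
    then show ?thesis by (simp only: q if_False)
  qed
  assume le: "q_index z \<le> CARD('r)"
  then have ex: "Ex P" by (auto simp only: q split: if_splits)
  note Pq = Pq[OF ex]
  then obtain l where l: "q_index z = Suc l" by (cases "q_index z") (auto simp: P_def)
  have "\<not> P l" using not_less_Least[of l P] ex l unfolding q by simp
  then have "init_prod z l = 1"
  \<comment> \<open>For l = 0 minimality says nothing, because P excludes 0, but the empty product
    is 1.\<close>
  proof (cases "l = 0")
    case True
    then show ?thesis by (simp add: init_prod_initial_indices)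
  next
    case False
    with \<open>\<not> P l\<close> show ?thesis using l le by (simp add: P_def)
  qed
  moreover have "init_prod z (Suc l) = z $ nth_index (Suc l) * init_prod z l"
    using initial_indices_Suc[of l, where 'r = 'r] le l
    by (simp add: init_prod_initial_indices)
  ultimately show "z $ nth_index (q_index z) \<noteq> 1" using Pq l by (simp add: P_def)
qed

section \<open>Decreasing chains of indices and nested sums\<close>

definition chains :: "nat \<Rightarrow> nat \<Rightarrow> nat \<Rightarrow> ('r::{finite,linorder} \<Rightarrow> nat) set" where
  "chains N k m = {n \<in> initial_indices k \<rightarrow>\<^sub>E {m<..<N}.
     \<forall>i\<in>initial_indices k. \<forall>j\<in>initial_indices k. i < j \<longrightarrow> n i > n j}"

lemma finite_chains: "finite (chains N k m :: ('r::{finite,linorder} \<Rightarrow> nat) set)"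
  by (rule finite_subset[of _ "initial_indices k \<rightarrow>\<^sub>E {m<..<N}"]) (auto simp: chains_def intro: finite_PiE)

text \<open>The newly added index is the largest in the order, hence carries the smallest value v,
  and the remaining values form a chain above v. Because chains are \<open>undefined\<close> off
  their domain, restricting and updating are mutually inverse.\<close>

lemma sum_chains_Suc:
  fixes F :: "('r::{finite,linorder} \<Rightarrow> nat) \<Rightarrow> complex"
  assumes k: "Suc k \<le> CARD('r)"
  shows "(\<Sum>n\<in>chains N (Suc k) m. F n)
    = (\<Sum>v\<in>{m<..<N}. \<Sum>n\<in>chains N k v. F (n(nth_index (Suc k) := v)))"
proof -
  let ?p = "nth_index (Suc k) :: 'r"
  note I = initial_indices_Suc[OF k]
  have "(\<Sum>v\<in>{m<..<N}. \<Sum>n\<in>chains N k v. F (n(?p := v)))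
      = (\<Sum>(v, n)\<in>(SIGMA v:{m<..<N}. chains N k v). F (n(?p := v)))"
    by (intro sum.Sigma) (auto intro: finite_chains)
  also have "\<dots> = (\<Sum>n\<in>chains N (Suc k) m. F n)"
  proof (rule sum.reindex_bij_witness[where i = "\<lambda>n. (n ?p, restrict n (initial_indices k))"
        and j = "\<lambda>(v, n). n(?p := v)"])
    fix a assume "a \<in> (SIGMA v:{m<..<N}. (chains N k v :: ('r \<Rightarrow> nat) set))"
    then obtain v n where a: "a = (v, n)" and v: "v \<in> {m<..<N}" and n: "n \<in> chains N k v" by auto
    have mn: "v < n i" "n i < N" if "i \<in> initial_indices k" for i
      using n that by (auto simp: chains_def PiE_def Pi_def)
    have dec: "n j < n i" if "i \<in> initial_indices k" "j \<in> initial_indices k" "i < j" for i j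
      using n that by (auto simp: chains_def)
    have undef: "n i = undefined" if "i \<notin> initial_indices k" for i
      using n that by (auto simp: chains_def PiE_def extensional_def)
    have "restrict (n(?p := v)) (initial_indices k) = n"
      using I(2) undef by (auto simp: restrict_def fun_eq_iff)
    then show "(\<lambda>n. (n ?p, restrict n (initial_indices k))) ((\<lambda>(v, n). n(?p := v)) a) = a"
      by (simp add: a)
    have "n(?p := v) \<in> chains N (Suc k) m"
      unfolding chains_def mem_Collect_eq I(1)
    proof (intro conjI ballI impI PiE_I)
      fix i j assume ij: "i \<in> insert ?p (initial_indices k)" "j \<in> insert ?p (initial_indices k)" "i < j"
      then have i: "i \<noteq> ?p" "i \<in> initial_indices k" using I(3) by (auto dest: order_less_asym)
      show "(n(?p := v)) j < (n(?p := v)) i"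
      proof (cases "j = ?p")
        case True
        then show ?thesis using i mn(1)[OF i(2)] by simp
      next
        case False
        then show ?thesis using i ij dec[OF i(2) _ ij(3)] by simp
      qed
    next
      fix i assume "i \<in> insert ?p (initial_indices k)"
      then show "(n(?p := v)) i \<in> {m<..<N}"
        using v mn[of i] by (cases "i = ?p") auto
    next
      fix i assume "i \<notin> insert ?p (initial_indices k)"
      then show "(n(?p := v)) i = undefined" using undef[of i] by simp
    qed
    then show "(\<lambda>(v, n). n(?p := v)) a \<in> chains N (Suc k) m" by (simp add: a)
    show "F ((\<lambda>(v, n). n(?p := v)) a) = (case a of (v, n) \<Rightarrow> F (n(?p := v)))" by (simp add: a)
  next
    fix n :: "'r \<Rightarrow> nat" assume n: "n \<in> chains N (Suc k) m"
    have mn: "m < n i" "n i < N" if "i \<in> initial_indices (Suc k)" for i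
      using n that by (auto simp: chains_def PiE_def Pi_def)
    have dec: "n j < n i" if "i \<in> initial_indices (Suc k)" "j \<in> initial_indices (Suc k)" "i < j" for i j
      using n that by (auto simp: chains_def)
    have undef: "n i = undefined" if "i \<notin> initial_indices (Suc k)" for i
      using n that by (auto simp: chains_def PiE_def extensional_def)
    have "(restrict n (initial_indices k))(?p := n ?p) = n"
    proof
      fix i :: 'r
      show "((restrict n (initial_indices k))(?p := n ?p)) i = n i"
        using undef[of i] by (cases "i = ?p"; cases "i \<in> initial_indices k") (simp_all add: I(1))
    qed
    then show "(\<lambda>(v, n). n(?p := v)) (n ?p, restrict n (initial_indices k)) = n" by simp
    have "restrict n (initial_indices k) \<in> chains N k (n ?p)"
      unfolding chains_def mem_Collect_eq
    proof (intro conjI ballI impI PiE_I)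
      fix i :: 'r assume "i \<in> initial_indices k"
      then show "restrict n (initial_indices k) i \<in> {n ?p<..<N}"
        using I(3)[of i] dec[of i ?p] mn[of i] by (simp add: I(1))
    next
      fix i j :: 'r assume "i \<in> initial_indices k" "j \<in> initial_indices k" "i < j"
      then show "restrict n (initial_indices k) j < restrict n (initial_indices k) i"
        using dec[of i j] by (simp add: I(1))
    qed simp
    moreover have "n ?p \<in> {m<..<N}" using mn[of ?p] by (simp add: I(1))
    ultimately show "(n ?p, restrict n (initial_indices k)) \<in> (SIGMA v:{m<..<N}. chains N k v)" by simp
  qed
  finally show ?thesis by simp
qed

lemma sum_chains_eq_nested_sum:
  fixes z s :: "complex ^ 'r::{finite,linorder}"
  shows "k \<le> CARD('r) \<Longrightarrow>
    (\<Sum>n\<in>chains N k m. \<Prod>i\<in>initial_indices k. z $ i ^ n i / of_nat (n i) powr (s $ i))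
      = nested_sum (\<lambda>k. z $ nth_index k) (\<lambda>k. s $ nth_index k) (\<lambda>_. 1) N k m"
proof (induction k arbitrary: m)
  case 0
  then show ?case by (simp add: chains_def)
next
  case (Suc k)
  let ?p = "nth_index (Suc k) :: 'r"
  let ?x = "\<lambda>i v. z $ i ^ v / of_nat v powr (s $ i)"
  note I = initial_indices_Suc[OF Suc.prems]
  have "(\<Prod>i\<in>initial_indices (Suc k). ?x i ((n(?p := v)) i)) = ?x ?p v * (\<Prod>i\<in>initial_indices k. ?x i (n i))"
    for n v
  proof -
    have "(\<Prod>i\<in>initial_indices k. ?x i ((n(?p := v)) i)) = (\<Prod>i\<in>initial_indices k. ?x i (n i))"
      using I(2) by (intro prod.cong) auto
    then show ?thesis unfolding I(1) using I(2) by simp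
  qed
  then have "(\<Sum>n\<in>chains N (Suc k) m. \<Prod>i\<in>initial_indices (Suc k). ?x i (n i))
      = (\<Sum>v\<in>{m<..<N}. ?x ?p v * (\<Sum>n\<in>chains N k v. \<Prod>i\<in>initial_indices k. ?x i (n i)))"
    by (simp only: sum_chains_Suc[OF Suc.prems] sum_distrib_left)
  also have "\<dots> = (\<Sum>v\<in>{m<..<N}. ?x ?p v *
      nested_sum (\<lambda>k. z $ nth_index k) (\<lambda>k. s $ nth_index k) (\<lambda>_. 1) N k v)"
    using Suc.prems by (simp only: Suc.IH[OF Suc_leD])
  finally show ?case by simp
qed

lemma polylog_partial_eq_nested_sum:
  "polylog_partial z s N =
     nested_sum (\<lambda>k. z $ nth_index k) (\<lambda>k. s $ nth_index k) (\<lambda>_. 1) N CARD('r) 0"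
  for z s :: "complex ^ 'r::{finite,linorder}"
proof -
  have "(multi_indices N :: ('r \<Rightarrow> nat) set) = chains N CARD('r) 0"
    by (auto simp: multi_indices_def chains_def initial_indices_CARD)
  then show ?thesis
    by (simp add: sum_chains_eq_nested_sum[symmetric] polylog_partial_def polylog_term_def
          initial_indices_CARD prod_dividef)
qed

section \<open>Locally uniform convergence of the partial sums\<close>

lemma region_neighbourhood:
  fixes z :: "complex ^ 'r::{finite,linorder}"
  assumes s0: "s0 \<in> U_dom z"
  shows "\<exists>d>0. \<exists>\<rho>>0. \<exists>R. \<forall>s\<in>ball s0 \<rho>. (\<lambda>k. s $ nth_index k) \<in> region CARD('r) (q_index z) d R"
proof -
  let ?G = "\<lambda>k. Re (init_sum s0 k) - abscissa (q_index z) k"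
  have G: "?G k > 0" if "k \<in> {1..CARD('r)}" for k
  proof (cases "k < q_index z")
    case True
    then show ?thesis using s0 that by (auto simp: U_dom_def abscissa_def)
  next
    case False
    then have "real k - 1 < Re (init_sum s0 k)" using s0 that by (auto simp: U_dom_def)
    then show ?thesis using False that by (simp add: abscissa_def of_nat_diff)
  qed
  \<comment> \<open>A third of the smallest gap in the finitely many strict inequalities at s0: the
    margin 2 * d then holds strictly at s0, hence in a neighbourhood.\<close>
  define d where "d = Min (?G ` {1..CARD('r)}) / 3"
  have ne: "{1..CARD('r)} \<noteq> {}" using q_index_ge_1[of z] by (simp add: Suc_le_eq)
  have d: "d > 0" unfolding d_def using G ne by (simp add: Min_gr_iff)
  have dG: "3 * d \<le> ?G k" if "k \<in> {1..CARD('r)}" for k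
    unfolding d_def using that by simp
  define V where "V = (\<Inter>k\<in>{1..CARD('r)}. {s :: complex ^ 'r::{finite,linorder}. norm (s $ nth_index k) < norm s0 + 1} \<inter>
     {s. abscissa (q_index z) k + 2 * d < Re (init_sum s k)})"
  have "open V"
    unfolding V_def init_sum_def by (intro open_INT open_Int ballI open_Collect_less continuous_intros) auto
  moreover have "s0 \<in> V"
    unfolding V_def
  proof (intro INT_I IntI CollectI)
    fix k assume "k \<in> {1..CARD('r)}"
    then show "abscissa (q_index z) k + 2 * d < Re (init_sum s0 k)" using dG[of k] d by simp
    show "norm (s0 $ nth_index k) < norm s0 + 1" by (intro order_le_less_trans[OF Finite_Cartesian_Product.norm_nth_le]) simp
  qed
  ultimately obtain \<rho> where \<rho>: "\<rho> > 0" "ball s0 \<rho> \<subseteq> V" using open_contains_ball by blast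
  have "(\<lambda>k. s $ nth_index k) \<in> region CARD('r) (q_index z) d (norm s0 + 1)" if "s \<in> ball s0 \<rho>" for s
    unfolding region_def mem_Collect_eq
  proof
    fix k assume k: "k \<in> {1..CARD('r)}"
    have "s \<in> V" using \<rho>(2) that by (rule subsetD)
    from INT_D[OF this[unfolded V_def] k]
    have "norm (s $ nth_index k) < norm s0 + 1" "abscissa (q_index z) k + 2 * d < Re (init_sum s k)"
      by simp_all
    then show "norm (s $ nth_index k) \<le> norm s0 + 1 \<and>
        abscissa (q_index z) k + 2 * d \<le> (\<Sum>j=1..k. Re (s $ nth_index j))"
      using k by (simp add: init_sum_eq)
  qed
  with d \<rho>(1) show ?thesis by blast
qed

lemma polylog_partial_uniformly_Cauchy:
  fixes z :: "complex ^ 'r::{finite,linorder}"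
  assumes z: "\<And>i. norm (z $ i) \<le> 1" and s0: "s0 \<in> U_dom z"
  shows "\<exists>\<rho>>0. uniformly_Cauchy_on (ball s0 \<rho>) (\<lambda>N s. polylog_partial z s N)"
proof -
  obtain d \<rho> R where d: "d > 0" and \<rho>: "\<rho> > 0" and
    reg: "\<forall>s\<in>ball s0 \<rho>. (\<lambda>k. s $ nth_index k) \<in> region CARD('r) (q_index z) d R"
    using region_neighbourhood[OF s0] by (elim exE conjE)
  let ?w = "\<lambda>k. z $ nth_index k"
  have "\<exists>C. \<forall>u\<in>region CARD('r) (q_index z) d R. \<forall>M>0. \<forall>N.
      norm (nested_sum ?w u (tail_from M) N CARD('r) 0) \<le> C * real M powr (- d)"
    by (rule nested_sum_cauchy_bound)
      (use q_index_ge_1[of z] in \<open>simp_all add: z nth_q_index_neq_1 d Suc_le_eq\<close>)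
  then obtain C where C: "\<forall>u\<in>region CARD('r) (q_index z) d R. \<forall>M>0. \<forall>N.
      norm (nested_sum ?w u (tail_from M) N CARD('r) 0) \<le> C * real M powr (- d)" ..
  have bound: "dist (polylog_partial z s M) (polylog_partial z s N) \<le> C * real M powr (- d)"
    if "s \<in> ball s0 \<rho>" "M > 0" "M \<le> N" for s M N
  proof -
    \<comment> \<open>At m = 0 the guard of \<open>nested_sum_diff\<close> holds because M >
      0.\<close>
    have "polylog_partial z s N - polylog_partial z s M
        = nested_sum ?w (\<lambda>k. s $ nth_index k) (tail_from M) N CARD('r) 0"
      using nested_sum_diff[OF \<open>M \<le> N\<close>, of ?w "\<lambda>k. s $ nth_index k" "CARD('r)" 0] \<open>M > 0\<close>
      by (simp add: polylog_partial_eq_nested_sum)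
    with bspec[OF C bspec[OF reg that(1)], rule_format, OF that(2), of N] show ?thesis
      unfolding dist_norm norm_minus_commute[of "polylog_partial z s M"] by simp
  qed
  have lim: "(\<lambda>M. C * real M powr (- d)) \<longlonglongrightarrow> C * 0"
    using d by (intro tendsto_intros tendsto_neg_powr filterlim_real_sequentially) auto
  have "uniformly_Cauchy_on (ball s0 \<rho>) (\<lambda>N s. polylog_partial z s N)"
    unfolding uniformly_Cauchy_on_def
  proof (intro allI impI)
    fix e :: real assume e: "e > 0"
    have "\<forall>\<^sub>F M in sequentially. C * real M powr (- d) < e"
      using order_tendstoD(2)[OF lim, of e] e by simp
    then obtain K where K: "\<And>M. M \<ge> K \<Longrightarrow> C * real M powr (- d) < e"
      unfolding eventually_sequentially by blast
    \<comment> \<open>Starting at \<open>Suc K\<close> makes M and N positive, as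
      \<open>bound\<close> requires.\<close>
    have "dist (polylog_partial z s M) (polylog_partial z s N) < e"
      if "s \<in> ball s0 \<rho>" "M \<ge> Suc K" "N \<ge> Suc K" for s M N
    proof (cases "M \<le> N")
      case True
      then show ?thesis using bound[of s M N] K[of M] that by simp
    next
      case False
      then show ?thesis using bound[of s N M] K[of N] that by (simp add: dist_commute)
    qed
    then show "\<exists>K. \<forall>s\<in>ball s0 \<rho>. \<forall>M\<ge>K. \<forall>N\<ge>K. dist (polylog_partial z s M) (polylog_partial z s N) < e"
      by blast
  qed
  with \<rho> show ?thesis by blast
qed

section \<open>Holomorphy of the partial sums and of the limit\<close>

lemma several_holomorphic_on_sum:
  assumes "\<And>a. a \<in> A \<Longrightarrow> several_holomorphic_on (f a) U"
  shows "several_holomorphic_on (\<lambda>s. \<Sum>a\<in>A. f a s) U"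
  unfolding several_holomorphic_on_def
proof
  fix s assume s: "s \<in> U"
  have "\<forall>a\<in>A. \<exists>D. (f a has_derivative D) (at s within U) \<and> (\<forall>c h. D (c *s h) = c * D h)"
    using assms s by (simp add: several_holomorphic_on_def)
  then obtain D where D: "\<And>a. a \<in> A \<Longrightarrow> (f a has_derivative D a) (at s within U)"
    "\<And>a c h. a \<in> A \<Longrightarrow> D a (c *s h) = c * D a h"
    by (auto dest!: bchoice)
  show "\<exists>D. ((\<lambda>s. \<Sum>a\<in>A. f a s) has_derivative D) (at s within U) \<and> (\<forall>c h. D (c *s h) = c * D h)"
    by (intro exI[of _ "\<lambda>h. \<Sum>a\<in>A. D a h"] conjI has_derivative_sum D allI)
       (simp_all add: D sum_distrib_left)
qed

text \<open>For positive n_i the term is a constant times the exponential of a complex-linear form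
  in s. Positivity matters because \<open>0 powr s\<close> is 0 and not an exponential.\<close>

lemma several_holomorphic_on_polylog_term:
  fixes z :: "complex ^ 'r::{finite,linorder}"
  assumes n: "\<And>i. n i > 0"
  shows "several_holomorphic_on (\<lambda>s. polylog_term z s n) U"
proof -
  define l where "l s = (\<Sum>i\<in>UNIV. s $ i * - ln (of_nat (n i)))" for s :: "complex ^ 'r::{finite,linorder}"
  define P where "P = (\<Prod>i\<in>UNIV. z $ i ^ n i)"
  have eq: "polylog_term z s n = P * exp (l s)" for s
  proof -
    have "(\<Prod>i\<in>UNIV. of_nat (n i) powr (s $ i)) = exp (- l s)"
    proof -
      have "of_nat (n i) powr (s $ i) = exp (s $ i * ln (of_nat (n i)))" for i
        using n[of i] by (simp add: powr_def)
      moreover have "- l s = (\<Sum>i\<in>UNIV. s $ i * ln (of_nat (n i)))"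
        by (simp add: l_def sum_negf)
      ultimately show ?thesis by (simp only: exp_sum finite)
    qed
    then show ?thesis
      by (simp only: polylog_term_def P_def exp_minus divide_inverse inverse_inverse_eq)
  qed
  have "((\<lambda>s. P * exp (l s)) has_derivative (\<lambda>h. P * (exp (l s) * l h))) (at s within U)" for s
  proof -
    have "(l has_derivative l) (at s within U)"
      unfolding l_def
      by (intro has_derivative_sum has_derivative_mult_left bounded_linear_imp_has_derivative bounded_linear_vec_nth)
    from has_derivative_compose[OF this DERIV_exp[unfolded has_field_derivative_def]]
    show ?thesis by (rule has_derivative_mult_right)
  qed
  moreover have "l (c *s h) = c * l h" for c h by (simp add: l_def sum_distrib_left mult.assoc)
  ultimately show ?thesis unfolding several_holomorphic_on_def eq
    by (intro ballI exI conjI allI) (assumption | simp add: mult_ac)+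
qed

theorem theorem2:
  fixes z :: "complex ^ 'r::{finite,linorder}"
  assumes "\<And>i. norm (z $ i) \<le> 1"
  shows "(\<forall>s\<in>U_dom z. convergent (\<lambda>N. polylog_partial z s N)) \<and>
         several_holomorphic_on (\<lambda>s. lim (\<lambda>N. polylog_partial z s N)) (U_dom z)"
proof
  note cauchy = polylog_partial_uniformly_Cauchy[OF assms]
  show conv: "\<forall>s\<in>U_dom z. convergent (\<lambda>N. polylog_partial z s N)"
  proof
    fix s assume "s \<in> U_dom z"
    then obtain \<rho> where "\<rho> > 0" "uniformly_Cauchy_on (ball s \<rho>) (\<lambda>N s. polylog_partial z s N)"
      using cauchy by blast
    then show "convergent (\<lambda>N. polylog_partial z s N)"
      unfolding Cauchy_convergent_iff[symmetric] by (auto intro: uniformly_Cauchy_imp_Cauchy)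
  qed
  show "several_holomorphic_on (\<lambda>s. lim (\<lambda>N. polylog_partial z s N)) (U_dom z)"
  proof (rule several_holomorphic_on_uniform_limit[OF open_U_dom _ cauchy])
    show "several_holomorphic_on (\<lambda>s. polylog_partial z s N) (U_dom z)" for N
      unfolding polylog_partial_def
      by (intro several_holomorphic_on_sum several_holomorphic_on_polylog_term) (auto simp: multi_indices_def)
    show "(\<lambda>N. polylog_partial z s N) \<longlonglongrightarrow> lim (\<lambda>N. polylog_partial z s N)" if "s \<in> U_dom z" for s
      using conv that by (simp add: convergent_LIMSEQ_iff)
  qed
qed

end
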